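(* For integers $n\ge k\ge0$, $$\mathcal{B}_{n,2k}^{(k)}(1)=k!\sum_{\nu=0}^{k}\binom{2k-n}{k-\nu}\,\mathfrak{B}_{n,\nu}.$$
   Context: Bernoulli polynomials: $\frac{te^{xt}}{e^t-1}=\sum_{n\ge0}\mathbf{B}_n(x)\frac{t^n}{n!}$, and $\mathbf{B}_n=\mathbf{B}_n(0)$ (so $\mathbf{B}_1=-\frac12$). Generalized reciprocal Bernoulli polynomials: $\mathcal{B}_{n,k}(x)=x^k\,\mathbf{B}_n(x^{-1})$ for $n\ge0$, $k\in\mathbb{Z}$; $\mathcal{B}_{n,k}^{(\ell)}$ denotes the $\ell$-th derivative in $x$. The numbers $\mathfrak{B}_{n,k}$ are $$\mathfrak{B}_{n,k}=\sum_{\nu=k}^{n}\binom{n}{\nu}\binom{\nu}{k}\mathbf{B}_\nu\qquad(0\le k\le n).$$ Binomial coefficients $\binom{a}{j}=a(a-1)\cdots(a-j+1)/j!$ are allowed with negative integer upper argument $a$. *)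

theory Defs
  imports "HOL-Computational_Algebra.Formal_Power_Series" "HOL-Analysis.Analysis"
begin

text \<open>
  The quotient is taken in the ring of formal power series over the reals; since
  \<open>fps_exp 1 - 1\<close> has subdegree 1, it divides \<open>fps_X * fps_exp x\<close> exactly.
\<close>

definition bernoulli_poly :: "nat \<Rightarrow> real \<Rightarrow> real" where
  "bernoulli_poly n x = fact n * fps_nth (fps_X * fps_exp x / (fps_exp 1 - 1)) n"

definition bernoulli_num :: "nat \<Rightarrow> real" where
  "bernoulli_num n = bernoulli_poly n 0"

lemma bernoulli_poly_generating_function:
  "(fps_exp 1 - 1) * Abs_fps (\<lambda>n. bernoulli_poly n x / fact n) = fps_X * fps_exp x"
proof -
  let ?g = "fps_exp 1 - 1 :: real fps"
  have g: "fps_nth ?g 0 = 0" "fps_nth ?g 1 = 1" by simp_all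
  hence sub: "subdegree ?g = 1" by (intro subdegreeI) auto
  have nz: "?g \<noteq> 0" using g(2) by (metis fps_zero_nth zero_neq_one)
  have "subdegree (fps_X * fps_exp x :: real fps) \<ge> 1" by (intro subdegree_geI) auto
  hence "?g dvd fps_X * fps_exp x" using nz sub by (subst fps_dvd_iff) auto
  moreover have "Abs_fps (\<lambda>n. bernoulli_poly n x / fact n) = fps_X * fps_exp x / ?g"
    by (simp add: fps_eq_iff bernoulli_poly_def)
  ultimately show ?thesis by simp
qed

text \<open>
  At \<open>x = 0\<close> the conventions \<open>inverse 0 = 0\<close> and \<open>0 powi k = 0\<close> for \<open>k \<noteq> 0\<close> make the value
  an artefact, so the definition carries its meaning only for \<open>x \<noteq> 0\<close>.
\<close>

definition recip_bernoulli_poly :: "nat \<Rightarrow> int \<Rightarrow> real \<Rightarrow> real" where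
  "recip_bernoulli_poly n k x = x powi k * bernoulli_poly n (inverse x)"

definition frak_B :: "nat \<Rightarrow> nat \<Rightarrow> real" where
  "frak_B n k = (\<Sum>\<nu>=k..n. real (n choose \<nu>) * real (\<nu> choose k) * bernoulli_num \<nu>)"

end

theory Submission
  imports Defs
begin

text \<open>Expanding the Bernoulli polynomial by powers makes the reciprocal one, away from 0, a
  finite combination of integer powers x^(2k-n+\<mu>) with coefficients binom(n,\<mu>) B_\<mu>
  (\<open>recip_bernoulli_poly_eq_sum\<close>). Its k-th derivative at 1 is then k! times the sum of
  these coefficients times binom(2k-n+\<mu>, k) (\<open>higher_deriv_sum_powi\<close>). Vandermonde
  convolution separates \<mu> from 2k-n in this binomial, and after exchanging the sums the inner
  sum over \<mu> is \<open>frak_B n \<nu>\<close>.\<close>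

lemma bernoulli_poly_eq_sum:
  "bernoulli_poly n x = (\<Sum>\<nu>\<le>n. real (n choose \<nu>) * bernoulli_num \<nu> * x ^ (n - \<nu>))"
proof -
  define A :: "real \<Rightarrow> real fps" where "A y = Abs_fps (\<lambda>n. bernoulli_poly n y / fact n)" for y
  have gen: "(fps_exp 1 - 1) * A y = fps_X * fps_exp y" for y
    unfolding A_def by (rule bernoulli_poly_generating_function)
  have "fps_nth (fps_exp 1 - 1 :: real fps) 1 \<noteq> 0"
    by simp
  then have nz: "fps_exp 1 - 1 \<noteq> (0 :: real fps)"
    by (metis fps_zero_nth)
  \<comment> \<open>Both sides equal X e^(xt). Power series over a field form an integral domain, so
    the nonzero factor e^t - 1 cancels.\<close>
  have "(fps_exp 1 - 1) * A x = (fps_exp 1 - 1) * (A 0 * fps_exp x)"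
    using gen[of 0] by (simp add: gen mult.assoc[symmetric])
  then have "A x = A 0 * fps_exp x"
    using nz by simp
  then have "fps_nth (A x) n = (\<Sum>\<nu>=0..n. bernoulli_num \<nu> / fact \<nu> * (x ^ (n - \<nu>) / fact (n - \<nu>)))"
    by (simp add: fps_mult_nth A_def bernoulli_num_def)
  then have "bernoulli_poly n x =
      (\<Sum>\<nu>=0..n. fact n * (bernoulli_num \<nu> / fact \<nu> * (x ^ (n - \<nu>) / fact (n - \<nu>))))"
    by (simp add: A_def field_simps sum_distrib_left)
  also have "\<dots> = (\<Sum>\<nu>\<le>n. real (n choose \<nu>) * bernoulli_num \<nu> * x ^ (n - \<nu>))"
    by (intro sum.cong) (auto simp: binomial_fact atLeast0AtMost field_simps)
  finally show ?thesis .
qed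

lemma recip_bernoulli_poly_eq_sum:
  assumes "x \<noteq> 0"
  shows "recip_bernoulli_poly n k x
    = (\<Sum>\<nu>\<le>n. real (n choose \<nu>) * bernoulli_num \<nu> * x powi (k - int n + int \<nu>))"
proof -
  have "x powi k * inverse x ^ (n - \<nu>) = x powi (k - int n + int \<nu>)" if "\<nu> \<le> n" for \<nu>
  proof -
    have "x powi k * inverse x ^ (n - \<nu>) = x powi (k - int (n - \<nu>))"
      using assms by (simp add: power_int_diff power_inverse divide_inverse)
    also have "k - int (n - \<nu>) = k - int n + int \<nu>"
      using that by simp
    finally show ?thesis .
  qed
  then show ?thesis
    unfolding recip_bernoulli_poly_def bernoulli_poly_eq_sum sum_distrib_left
    by (intro sum.cong) (auto simp: mult.left_commute)
qed

text \<open>The falling factorial m(m-1)...(m-k+1) is k! binom(m,k), also for negative m. The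
  formula for f is assumed only off 0, where negative powers have their true meaning.\<close>

lemma higher_deriv_sum_powi:
  fixes f :: "real \<Rightarrow> real" and c :: "'a \<Rightarrow> real" and m :: "'a \<Rightarrow> int"
  assumes f: "\<And>x. x \<noteq> 0 \<Longrightarrow> f x = (\<Sum>a\<in>A. c a * x powi m a)"
    and "x \<noteq> 0"
  shows "(deriv ^^ k) f x
    = fact k * (\<Sum>a\<in>A. c a * (of_int (m a) gchoose k) * x powi (m a - int k))"
  using \<open>x \<noteq> 0\<close>
proof (induction k arbitrary: x)
  case 0
  then show ?case
    by (simp add: f)
next
  case (Suc k)
  let ?h = "\<lambda>k x. fact k * (\<Sum>a\<in>A. c a * (of_int (m a) gchoose k) * x powi (m a - int k))"
  \<comment> \<open>A derivative at x needs the induction hypothesis on a whole neighbourhood of x;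
    the complement of 0 is open and supplies one.\<close>
  have "eventually (\<lambda>y. y \<in> - {0}) (nhds x)"
    using Suc.prems by (intro eventually_nhds_in_open) auto
  then have "eventually (\<lambda>y. (deriv ^^ k) f y = ?h k y) (nhds x)"
    by eventually_elim (simp add: Suc.IH)
  then have "deriv ((deriv ^^ k) f) x = deriv (?h k) x"
    by (intro deriv_cong_ev) auto
  also have "\<dots> = fact k * (\<Sum>a\<in>A. c a * (of_int (m a) gchoose k) *
      (of_int (m a - int k) * x powi (m a - int k - 1)))"
    using Suc.prems
    by (intro DERIV_imp_deriv) (auto intro!: derivative_eq_intros sum.cong)
  also have "\<dots> = ?h (Suc k) x"
  proof -
    \<comment> \<open>The factor k+1 produced here turns k! into (k+1)!.\<close>
    have absorb: "(of_int (m a) gchoose k) * of_int (m a - int k)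
        = (1 + real k) * (of_int (m a) gchoose Suc k)" for a
      using gbinomial_absorb_comp[of "real_of_int (m a)" k] gbinomial_absorption[of k "real_of_int (m a)"]
      by (simp add: mult.commute)
    have "c a * (of_int (m a) gchoose k) * (of_int (m a - int k) * x powi (m a - int k - 1))
        = (1 + real k) * (c a * (of_int (m a) gchoose Suc k) * x powi (m a - int (Suc k)))" for a
    proof -
      have "c a * (of_int (m a) gchoose k) * (of_int (m a - int k) * y)
          = (1 + real k) * (c a * (of_int (m a) gchoose Suc k) * y)" for y
        using arg_cong[OF absorb[of a], of "\<lambda>z. c a * z * y"] by (simp only: mult_ac)
      moreover have "m a - int k - 1 = m a - int (Suc k)"
        by simp
      ultimately show ?thesis
        by (simp only:)
    qed
    then show ?thesis
      by (simp only: sum_distrib_left[symmetric]) simp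
  qed
  finally show ?case
    by simp
qed

theorem theorem5p9:
  fixes n k :: nat
  assumes "k \<le> n"
  shows "(deriv ^^ k) (recip_bernoulli_poly n (2 * int k)) 1
       = fact k * (\<Sum>\<nu>=0..k. (of_int (2 * int k - int n) gchoose (k - \<nu>)) * frak_B n \<nu>)"
proof -
  let ?b = "\<lambda>\<mu>. real (n choose \<mu>) * bernoulli_num \<mu>"
  let ?a = "of_int (2 * int k - int n) :: real"
  \<comment> \<open>Adding the terms with \<mu> < \<nu>, where binom(\<mu>,\<nu>) = 0, makes the
    range independent of \<nu>, so that the two sums can be exchanged.\<close>
  have frak: "frak_B n \<nu> = (\<Sum>\<mu>\<le>n. ?b \<mu> * real (\<mu> choose \<nu>))" for \<nu>
    unfolding frak_B_def
    by (intro sum.mono_neutral_cong_left) (auto simp: binomial_eq_0)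
  \<comment> \<open>Vandermonde holds for arbitrary real upper arguments, so 2k-n may be
    negative.\<close>
  have vandermonde: "of_int (2 * int k - int n + int \<mu>) gchoose k
      = (\<Sum>\<nu>=0..k. (?a gchoose (k - \<nu>)) * real (\<mu> choose \<nu>))" for \<mu>
    using gbinomial_Vandermonde[of "real \<mu>" ?a k]
    by (simp add: binomial_gbinomial mult.commute add.commute atLeast0AtMost)
  have "(deriv ^^ k) (recip_bernoulli_poly n (2 * int k)) 1
      = fact k * (\<Sum>\<mu>\<le>n. ?b \<mu> * (of_int (2 * int k - int n + int \<mu>) gchoose k))"
    by (subst higher_deriv_sum_powi[OF recip_bernoulli_poly_eq_sum]) simp_all
  also have "(\<Sum>\<mu>\<le>n. ?b \<mu> * (of_int (2 * int k - int n + int \<mu>) gchoose k))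
      = (\<Sum>\<nu>=0..k. (?a gchoose (k - \<nu>)) * frak_B n \<nu>)"
    unfolding vandermonde frak sum_distrib_left
    by (subst sum.swap) (simp add: mult_ac)
  finally show ?thesis .
qed

end
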